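(* Let $F,G\colon(\mathscr C,C)\to(\mathscr D,D)$ be computability transfers. Then the inserter of $F,G$ in $\mathsf{CatBaseComp}$ is $\big(\mathrm{DiAlg}(F,G),\mathrm{DiAlg}(F,G;C)\big)$, where $\mathrm{DiAlg}(F,G)$ is the category of dialgebras on $F,G$ and, for each object $(c,\alpha)$, $$\mathrm{DiAlg}(F,G;C)\big((c,\alpha)\big)=\bigcup_{(b,\beta)\in\mathrm{DiAlg}(F,G)}\{\,f\in\mathrm{DiAlg}(F,G)\big((b,\beta),(c,\alpha)\big)\mid f\in C(c)\,\}.$$ The computability transfer $X\colon\big(\mathrm{DiAlg}(F,G),\mathrm{DiAlg}(F,G;C)\big)\to(\mathscr C,C)$ of the inserter takes $(c,\alpha)$ to $c$ and $f$ to $f$, and the natural transformation $F\circ X\Rightarrow G\circ X$ is the same as for the inserter in the 2-category of categories, i.e. its component at $(c,\alpha)$ is $\alpha$.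
   Context: A base of computability $B$ in a category $\mathscr C$ is a family $(B(a))_{a\in\mathscr C_0}$, where each $B(a)$ is a subclass of the class $\mathrm{Mon}(-,a)$ of monomorphisms with codomain $a$, such that: (Base1) $1_a\in B(a)$ for every object $a$; (Base2) for all objects $a,b$, all $i\colon s\to a$ in $B(a)$, all $j\colon t\to b$ in $B(b)$, and all $f\colon s\to b$, there is a pullback of $j$ along $f$, with projection $f^*j\colon j^*(s)\to s$, such that $i\circ f^*j\in B(a)$. If $C$, $D$ are bases of computability in $\mathscr C$, $\mathscr D$, a computability transfer $F\colon(\mathscr C,C)\to(\mathscr D,D)$ is a functor $F\colon\mathscr C\to\mathscr D$ such that $F(i)\in D(F(a))$ for all objects $a$ and all $i\in C(a)$, and $F$ preserves all pullbacks occurring in (Base2) (i.e. pullbacks of arrows $j\in C(b)$ along arbitrary arrows $f\colon s\to b$). $\mathsf{CatBaseComp}$ is the 2-category with objects the categories with a base of computability, 1-cells the computability transfers, and 2-cells the natural transformations between underlying functors. $\mathrm{DiAlg}(F,G)$ has as objects pairs $(x,\gamma)$ with $x\in\mathscr C$ and $\gamma\colon F(x)\to G(x)$ in $\mathscr D$, and as arrows $(x,\gamma)\to(y,\delta)$ the arrows $f\colon x\to y$ of $\mathscr C$ with $\delta\circ F(f)=G(f)\circ\gamma$. An inserter of $f,g\colon A\to B$ in a 2-category is an object $I$ with a 1-cell $i\colon I\to A$ and a 2-cell $\alpha\colon f\circ i\Rightarrow g\circ i$ that is universal: (1) for every $j\colon J\to A$ and $\beta\colon f\circ j\Rightarrow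 g\circ j$ there is a unique $h\colon J\to I$ with $i\circ h=j$ and $\alpha*h=\beta$; (2) if $(j,\beta)$, $(j',\beta')$ are such data on the same object $J$, with induced 1-cells $h,h'$, and $\nu\colon j\Rightarrow j'$ satisfies $\beta'\circ(f*\nu)=(g*\nu)\circ\beta$, then there is a unique $\mu\colon h\Rightarrow h'$ with $i*\mu=\nu$. *)

theory Defs
  imports Main "HOL-Library.FuncSet"
begin

section \<open>Categories\<close>

record ('o, 'm) cat =
  Ob   :: "'o set"
  Ar   :: "'m set"
  Dom  :: "'m \<Rightarrow> 'o"
  Cod  :: "'m \<Rightarrow> 'o"
  Id   :: "'o \<Rightarrow> 'm"
  Comp :: "'m \<Rightarrow> 'm \<Rightarrow> 'm"  (infixr "\<cdot>\<index>" 70)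

definition Hom :: "('o, 'm) cat \<Rightarrow> 'o \<Rightarrow> 'o \<Rightarrow> 'm set" where
  "Hom C a b = {f \<in> Ar C. Dom C f = a \<and> Cod C f = b}"

locale category =
  fixes C :: "('o, 'm) cat" (structure)
  assumes Dom_in: "f \<in> Ar C \<Longrightarrow> Dom C f \<in> Ob C"
    and Cod_in: "f \<in> Ar C \<Longrightarrow> Cod C f \<in> Ob C"
    and Id_in: "a \<in> Ob C \<Longrightarrow> Id C a \<in> Hom C a a"
    and Comp_in: "\<lbrakk>f \<in> Hom C a b; g \<in> Hom C b c\<rbrakk> \<Longrightarrow> g \<cdot> f \<in> Hom C a c"
    and Id_left: "f \<in> Hom C a b \<Longrightarrow> Id C b \<cdot> f = f"
    and Id_right: "f \<in> Hom C a b \<Longrightarrow> f \<cdot> Id C a = f"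
    and Comp_assoc: "\<lbrakk>f \<in> Hom C a b; g \<in> Hom C b c; h \<in> Hom C c d\<rbrakk>
      \<Longrightarrow> (h \<cdot> g) \<cdot> f = h \<cdot> (g \<cdot> f)"

definition mono_to :: "('o, 'm) cat \<Rightarrow> 'o \<Rightarrow> 'm set" where
  "mono_to C a = {i \<in> Ar C. Cod C i = a \<and>
     (\<forall>x. \<forall>g \<in> Hom C x (Dom C i). \<forall>h \<in> Hom C x (Dom C i).
        i \<cdot>\<^bsub>C\<^esub> g = i \<cdot>\<^bsub>C\<^esub> h \<longrightarrow> g = h)}"

text \<open>
  \<open>is_pullback C f j p q\<close>: the pair \<open>p\<close>, \<open>q\<close> is a pullback of \<open>j\<close> along \<open>f\<close>, where
  \<open>p\<close> is the projection to the domain of \<open>f\<close> (the arrow written \<open>f\<^sup>*j\<close>)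
  and \<open>q\<close> is the projection to the domain of \<open>j\<close>.
\<close>

definition is_pullback :: "('o, 'm) cat \<Rightarrow> 'm \<Rightarrow> 'm \<Rightarrow> 'm \<Rightarrow> 'm \<Rightarrow> bool" where
  "is_pullback C f j p q \<longleftrightarrow>
     f \<in> Ar C \<and> j \<in> Ar C \<and> Cod C f = Cod C j \<and>
     p \<in> Hom C (Dom C p) (Dom C f) \<and> q \<in> Hom C (Dom C p) (Dom C j) \<and>
     f \<cdot>\<^bsub>C\<^esub> p = j \<cdot>\<^bsub>C\<^esub> q \<and>
     (\<forall>x. \<forall>u \<in> Hom C x (Dom C f). \<forall>v \<in> Hom C x (Dom C j).
        f \<cdot>\<^bsub>C\<^esub> u = j \<cdot>\<^bsub>C\<^esub> v \<longrightarrow>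
        (\<exists>!w. w \<in> Hom C x (Dom C p) \<and> p \<cdot>\<^bsub>C\<^esub> w = u \<and> q \<cdot>\<^bsub>C\<^esub> w = v))"

section \<open>Functors and natural transformations\<close>

text \<open>
  The object and arrow maps of functors and the component families of natural
  transformations are required to be extensional (equal to \<open>undefined\<close> outside their
  mathematical domain), so that HOL equality is the intended equality.
  Compositions are restricted accordingly; the category supplied as first argument is the
  one on which the resulting functor or transformation is defined.
\<close>

datatype ('o, 'm, 'p, 'n) ftr = Ftr (omap: "'o \<Rightarrow> 'p") (amap: "'m \<Rightarrow> 'n")

definition is_functor :: "('o, 'm) cat \<Rightarrow> ('p, 'n) cat \<Rightarrow> ('o, 'm, 'p, 'n) ftr \<Rightarrow> bool" where
  "is_functor C D F \<longleftrightarrow>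
     category C \<and> category D \<and>
     omap F \<in> Ob C \<rightarrow>\<^sub>E Ob D \<and> amap F \<in> Ar C \<rightarrow>\<^sub>E Ar D \<and>
     (\<forall>a b. \<forall>f \<in> Hom C a b. amap F f \<in> Hom D (omap F a) (omap F b)) \<and>
     (\<forall>a \<in> Ob C. amap F (Id C a) = Id D (omap F a)) \<and>
     (\<forall>a b c. \<forall>f \<in> Hom C a b. \<forall>g \<in> Hom C b c.
        amap F (g \<cdot>\<^bsub>C\<^esub> f) = amap F g \<cdot>\<^bsub>D\<^esub> amap F f)"

definition ftr_comp ::
  "('o, 'm) cat \<Rightarrow> ('p, 'n, 'q, 'r) ftr \<Rightarrow> ('o, 'm, 'p, 'n) ftr \<Rightarrow> ('o, 'm, 'q, 'r) ftr" where
  "ftr_comp C G F = Ftr (\<lambda>a \<in> Ob C. omap G (omap F a)) (\<lambda>f \<in> Ar C. amap G (amap F f))"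

definition is_nat_trans ::
  "('o, 'm) cat \<Rightarrow> ('p, 'n) cat \<Rightarrow> ('o, 'm, 'p, 'n) ftr \<Rightarrow> ('o, 'm, 'p, 'n) ftr
     \<Rightarrow> ('o \<Rightarrow> 'n) \<Rightarrow> bool" where
  "is_nat_trans C D F G \<eta> \<longleftrightarrow>
     is_functor C D F \<and> is_functor C D G \<and>
     \<eta> \<in> extensional (Ob C) \<and>
     (\<forall>a \<in> Ob C. \<eta> a \<in> Hom D (omap F a) (omap G a)) \<and>
     (\<forall>a b. \<forall>f \<in> Hom C a b. \<eta> b \<cdot>\<^bsub>D\<^esub> amap F f = amap G f \<cdot>\<^bsub>D\<^esub> \<eta> a)"

text \<open>Vertical composition, and the whiskerings \<open>F * \<eta>\<close> and \<open>\<eta> * F\<close>.\<close>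

definition vcomp ::
  "('o, 'm) cat \<Rightarrow> ('p, 'n) cat \<Rightarrow> ('o \<Rightarrow> 'n) \<Rightarrow> ('o \<Rightarrow> 'n) \<Rightarrow> 'o \<Rightarrow> 'n" where
  "vcomp C D \<theta> \<eta> = (\<lambda>a \<in> Ob C. \<theta> a \<cdot>\<^bsub>D\<^esub> \<eta> a)"

definition whisker_left ::
  "('o, 'm) cat \<Rightarrow> ('p, 'n, 'q, 'r) ftr \<Rightarrow> ('o \<Rightarrow> 'n) \<Rightarrow> 'o \<Rightarrow> 'r" where
  "whisker_left C F \<eta> = (\<lambda>a \<in> Ob C. amap F (\<eta> a))"

definition whisker_right ::
  "('o, 'm) cat \<Rightarrow> ('p \<Rightarrow> 'r) \<Rightarrow> ('o, 'm, 'p, 'n) ftr \<Rightarrow> 'o \<Rightarrow> 'r" where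
  "whisker_right C \<eta> F = (\<lambda>a \<in> Ob C. \<eta> (omap F a))"

section \<open>Bases of computability\<close>

locale base_of_computability = category C
  for C :: "('o, 'm) cat" (structure) +
  fixes B :: "'o \<Rightarrow> 'm set"
  assumes Base_mono: "a \<in> Ob C \<Longrightarrow> B a \<subseteq> mono_to C a"
    and Base1: "a \<in> Ob C \<Longrightarrow> Id C a \<in> B a"
    and Base2: "\<lbrakk>a \<in> Ob C; b \<in> Ob C; i \<in> B a; j \<in> B b; f \<in> Hom C (Dom C i) b\<rbrakk>
      \<Longrightarrow> \<exists>p q. is_pullback C f j p q \<and> i \<cdot> p \<in> B a"

text \<open>
  The 2-category \<open>CatBaseComp\<close>: its cells live over arbitrary types, so it is given by
  type-polymorphic predicates for 0-, 1- and 2-cells together with the operations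
  \<^const>\<open>ftr_comp\<close>, \<^const>\<open>vcomp\<close>, \<^const>\<open>whisker_left\<close> and \<^const>\<open>whisker_right\<close>.
\<close>

type_synonym ('o, 'm) based_cat = "('o, 'm) cat \<times> ('o \<Rightarrow> 'm set)"

definition is_based_cat :: "('o, 'm) based_cat \<Rightarrow> bool" where
  "is_based_cat A \<longleftrightarrow> base_of_computability (fst A) (snd A)"

definition is_transfer ::
  "('o, 'm) based_cat \<Rightarrow> ('p, 'n) based_cat \<Rightarrow> ('o, 'm, 'p, 'n) ftr \<Rightarrow> bool" where
  "is_transfer A A' F \<longleftrightarrow>
     is_based_cat A \<and> is_based_cat A' \<and> is_functor (fst A) (fst A') F \<and>
     (\<forall>a \<in> Ob (fst A). \<forall>i \<in> snd A a. amap F i \<in> snd A' (omap F a)) \<and>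
     (\<forall>b \<in> Ob (fst A). \<forall>j \<in> snd A b. \<forall>s. \<forall>f \<in> Hom (fst A) s b. \<forall>p q.
        is_pullback (fst A) f j p q \<longrightarrow>
        is_pullback (fst A') (amap F f) (amap F j) (amap F p) (amap F q))"

definition is_2cell ::
  "('o, 'm) based_cat \<Rightarrow> ('p, 'n) based_cat \<Rightarrow> ('o, 'm, 'p, 'n) ftr \<Rightarrow> ('o, 'm, 'p, 'n) ftr
     \<Rightarrow> ('o \<Rightarrow> 'n) \<Rightarrow> bool" where
  "is_2cell A A' F G \<eta> \<longleftrightarrow>
     is_transfer A A' F \<and> is_transfer A A' G \<and> is_nat_trans (fst A) (fst A') F G \<eta>"

section \<open>Inserters\<close>

definition inserter_data ::
  "('o, 'm) based_cat \<Rightarrow> ('p, 'n) based_cat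
     \<Rightarrow> ('o, 'm, 'p, 'n) ftr \<Rightarrow> ('o, 'm, 'p, 'n) ftr
     \<Rightarrow> ('jo, 'jm) based_cat \<Rightarrow> ('jo, 'jm, 'o, 'm) ftr \<Rightarrow> ('jo \<Rightarrow> 'n) \<Rightarrow> bool" where
  "inserter_data A A' f g J j \<beta> \<longleftrightarrow>
     is_transfer J A j \<and>
     is_2cell J A' (ftr_comp (fst J) f j) (ftr_comp (fst J) g j) \<beta>"

text \<open>
  \<open>is_induced\<close>: \<open>h\<close> is a 1-cell with \<open>i \<circ> h = j\<close> and \<open>\<alpha> * h = \<beta>\<close>.
\<close>

definition is_induced ::
  "('io, 'im) based_cat \<Rightarrow> ('io, 'im, 'o, 'm) ftr \<Rightarrow> ('io \<Rightarrow> 'n)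
     \<Rightarrow> ('jo, 'jm) based_cat \<Rightarrow> ('jo, 'jm, 'o, 'm) ftr \<Rightarrow> ('jo \<Rightarrow> 'n)
     \<Rightarrow> ('jo, 'jm, 'io, 'im) ftr \<Rightarrow> bool" where
  "is_induced I i \<alpha> J j \<beta> h \<longleftrightarrow>
     is_transfer J I h \<and> ftr_comp (fst J) i h = j \<and> whisker_right (fst J) \<alpha> h = \<beta>"

text \<open>
  A HOL definition cannot quantify over types, so the types of objects and arrows of the
  test category \<open>J\<close> are parameters. A theorem in which they are type variables asserts the
  universal property for test categories over all types.
\<close>

definition is_inserter ::
  "'jo itself \<Rightarrow> 'jm itself \<Rightarrow> ('o, 'm) based_cat \<Rightarrow> ('p, 'n) based_cat
     \<Rightarrow> ('o, 'm, 'p, 'n) ftr \<Rightarrow> ('o, 'm, 'p, 'n) ftr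
     \<Rightarrow> ('io, 'im) based_cat \<Rightarrow> ('io, 'im, 'o, 'm) ftr \<Rightarrow> ('io \<Rightarrow> 'n) \<Rightarrow> bool" where
  "is_inserter _ _ A A' f g I i \<alpha> \<longleftrightarrow>
     is_based_cat I \<and> inserter_data A A' f g I i \<alpha> \<and>
     (\<forall>(J :: ('jo, 'jm) based_cat) j \<beta>.
        inserter_data A A' f g J j \<beta> \<longrightarrow> (\<exists>!h. is_induced I i \<alpha> J j \<beta> h)) \<and>
     (\<forall>(J :: ('jo, 'jm) based_cat) j \<beta> j' \<beta>' h h' \<nu>.
        inserter_data A A' f g J j \<beta> \<longrightarrow> inserter_data A A' f g J j' \<beta>' \<longrightarrow>
        is_induced I i \<alpha> J j \<beta> h \<longrightarrow> is_induced I i \<alpha> J j' \<beta>' h' \<longrightarrow>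
        is_2cell J A j j' \<nu> \<longrightarrow>
        vcomp (fst J) (fst A') \<beta>' (whisker_left (fst J) f \<nu>)
          = vcomp (fst J) (fst A') (whisker_left (fst J) g \<nu>) \<beta> \<longrightarrow>
        (\<exists>!\<mu>. is_2cell J I h h' \<mu> \<and> whisker_left (fst J) i \<mu> = \<nu>))"

section \<open>Dialgebras\<close>

text \<open>
  Since the same arrow of \<open>C\<close> may underlie several dialgebra homomorphisms, an arrow of
  \<open>DiAlg\<close> is recorded together with its domain and codomain, as a triple.
\<close>

definition DiAlg_Ob ::
  "('o, 'm) cat \<Rightarrow> ('p, 'n) cat \<Rightarrow> ('o, 'm, 'p, 'n) ftr \<Rightarrow> ('o, 'm, 'p, 'n) ftr
     \<Rightarrow> ('o \<times> 'n) set" where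
  "DiAlg_Ob C D F G = {(x, \<gamma>). x \<in> Ob C \<and> \<gamma> \<in> Hom D (omap F x) (omap G x)}"

definition DiAlg ::
  "('o, 'm) cat \<Rightarrow> ('p, 'n) cat \<Rightarrow> ('o, 'm, 'p, 'n) ftr \<Rightarrow> ('o, 'm, 'p, 'n) ftr
     \<Rightarrow> ('o \<times> 'n, ('o \<times> 'n) \<times> 'm \<times> ('o \<times> 'n)) cat" where
  "DiAlg C D F G =
     \<lparr> Ob = DiAlg_Ob C D F G,
       Ar = {((x, \<gamma>), f, (y, \<delta>)).
               (x, \<gamma>) \<in> DiAlg_Ob C D F G \<and> (y, \<delta>) \<in> DiAlg_Ob C D F G \<and>
               f \<in> Hom C x y \<and> \<delta> \<cdot>\<^bsub>D\<^esub> amap F f = amap G f \<cdot>\<^bsub>D\<^esub> \<gamma>},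
       Dom = (\<lambda>(u, f, v). u),
       Cod = (\<lambda>(u, f, v). v),
       Id = (\<lambda>u. (u, Id C (fst u), u)),
       Comp = (\<lambda>(v, g, w) (u, f, v'). (u, g \<cdot>\<^bsub>C\<^esub> f, w)) \<rparr>"

definition DiAlg_base ::
  "('o, 'm) cat \<Rightarrow> ('p, 'n) cat \<Rightarrow> ('o, 'm, 'p, 'n) ftr \<Rightarrow> ('o, 'm, 'p, 'n) ftr
     \<Rightarrow> ('o \<Rightarrow> 'm set) \<Rightarrow> 'o \<times> 'n \<Rightarrow> (('o \<times> 'n) \<times> 'm \<times> ('o \<times> 'n)) set" where
  "DiAlg_base C D F G B = (\<lambda>(c, \<alpha>). \<Union>(b, \<beta>) \<in> Ob (DiAlg C D F G).
     {(u, f, v) \<in> Hom (DiAlg C D F G) (b, \<beta>) (c, \<alpha>). f \<in> B c})"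

definition DiAlg_proj ::
  "('o, 'm) cat \<Rightarrow> ('p, 'n) cat \<Rightarrow> ('o, 'm, 'p, 'n) ftr \<Rightarrow> ('o, 'm, 'p, 'n) ftr
     \<Rightarrow> ('o \<times> 'n, ('o \<times> 'n) \<times> 'm \<times> ('o \<times> 'n), 'o, 'm) ftr" where
  "DiAlg_proj C D F G =
     Ftr (\<lambda>(c, \<alpha>) \<in> Ob (DiAlg C D F G). c) (\<lambda>(u, f, v) \<in> Ar (DiAlg C D F G). f)"

definition DiAlg_trans ::
  "('o, 'm) cat \<Rightarrow> ('p, 'n) cat \<Rightarrow> ('o, 'm, 'p, 'n) ftr \<Rightarrow> ('o, 'm, 'p, 'n) ftr
     \<Rightarrow> 'o \<times> 'n \<Rightarrow> 'n" where
  "DiAlg_trans C D F G = (\<lambda>(c, \<alpha>) \<in> Ob (DiAlg C D F G). \<alpha>)"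

end

theory Submission imports Defs begin

text \<open>
  On underlying categories the statement is the familiar fact that dialgebras form the inserter:
  a functor \<open>j\<close> into \<open>\<C>\<close> with a transformation \<open>\<beta> : F j \<Rightarrow> G j\<close> is the same thing as the functor
  \<open>x \<mapsto> (j x, \<beta> x)\<close> into \<open>DiAlg(F, G)\<close>, since naturality of \<open>\<beta>\<close> says that the arrows \<open>j f\<close> are
  homomorphisms; similarly, the compatibility condition on a 2-cell \<open>\<nu>\<close> says that its components
  are homomorphisms.

  What has to be added concerns pullbacks of arrows \<open>j\<close> in the base. Because \<open>G\<close> preserves such a
  pullback, with projections \<open>p\<close> and \<open>q\<close>, the pair \<open>G p\<close>, \<open>G q\<close> is a pullback in \<open>\<D>\<close>, and this
  has two consequences. Its existence part equips the vertex of the pullback with a dialgebra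
  structure for which \<open>p\<close> and \<open>q\<close> are homomorphisms (\<open>pullback_structure\<close>). Its uniqueness part
  shows that a mediating arrow between dialgebras is automatically a homomorphism, so that the
  projection \<open>X\<close> to \<open>\<C>\<close> reflects these pullbacks (\<open>DiAlg_pullback\<close>). Together they give the second
  base axiom for \<open>DiAlg(F, G)\<close>. The projection also preserves these pullbacks, because any pullback
  in \<open>DiAlg(F, G)\<close> is isomorphic to one that was lifted from \<open>\<C>\<close> (\<open>proj_pullback\<close>). Reflection is
  used once more to see that the induced functor \<open>x \<mapsto> (j x, \<beta> x)\<close> is a computability transfer.
\<close>

section \<open>Categories, functors and pullbacks\<close>

lemma in_Hom_iff: "f \<in> Hom C a b \<longleftrightarrow> f \<in> Ar C \<and> Dom C f = a \<and> Cod C f = b"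
  by (auto simp: Hom_def)

lemma (in category) Hom_Ob: "f \<in> Hom C a b \<Longrightarrow> a \<in> Ob C \<and> b \<in> Ob C"
  using Dom_in Cod_in by (auto simp: in_Hom_iff)

lemma functor_Ob: "\<lbrakk>is_functor C D F; a \<in> Ob C\<rbrakk> \<Longrightarrow> omap F a \<in> Ob D"
  by (auto simp: is_functor_def)

lemma functor_Hom:
  "\<lbrakk>is_functor C D F; f \<in> Hom C a b\<rbrakk> \<Longrightarrow> amap F f \<in> Hom D (omap F a) (omap F b)"
  by (auto simp: is_functor_def)

lemma functor_Id: "\<lbrakk>is_functor C D F; a \<in> Ob C\<rbrakk> \<Longrightarrow> amap F (Id C a) = Id D (omap F a)"
  by (auto simp: is_functor_def)

lemma functor_Comp:
  "\<lbrakk>is_functor C D F; f \<in> Hom C a b; g \<in> Hom C b c\<rbrakk>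
    \<Longrightarrow> amap F (g \<cdot>\<^bsub>C\<^esub> f) = amap F g \<cdot>\<^bsub>D\<^esub> amap F f"
  by (auto simp: is_functor_def)

lemma functor_category: "is_functor C D F \<Longrightarrow> category C \<and> category D"
  by (auto simp: is_functor_def)

lemma ftr_comp_functor:
  assumes F: "is_functor C D F" and G: "is_functor D E G"
  shows "is_functor C E (ftr_comp C G F)"
proof -
  interpret C: category C using F by (simp add: is_functor_def)
  interpret D: category D using F by (simp add: is_functor_def)
  have arr: "amap (ftr_comp C G F) f \<in> Hom E (omap (ftr_comp C G F) a) (omap (ftr_comp C G F) b)"
    if "f \<in> Hom C a b" for a b f
    using that functor_Hom[OF G functor_Hom[OF F that]] C.Hom_Ob[OF that]
    by (auto simp: ftr_comp_def in_Hom_iff)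
  have ar: "amap (ftr_comp C G F) \<in> Ar C \<rightarrow>\<^sub>E Ar E"
    using arr by (fastforce simp: in_Hom_iff ftr_comp_def)
  have ob: "omap (ftr_comp C G F) \<in> Ob C \<rightarrow>\<^sub>E Ob E"
    using functor_Ob[OF F] functor_Ob[OF G] by (auto simp: ftr_comp_def)
  have comp: "amap (ftr_comp C G F) (g \<cdot>\<^bsub>C\<^esub> f)
      = amap (ftr_comp C G F) g \<cdot>\<^bsub>E\<^esub> amap (ftr_comp C G F) f"
    if "f \<in> Hom C a b" "g \<in> Hom C b c" for a b c f g
    using that C.Comp_in[OF that] functor_Comp[OF F that]
      functor_Comp[OF G functor_Hom[OF F that(1)] functor_Hom[OF F that(2)]]
    by (auto simp: ftr_comp_def in_Hom_iff)
  have idm: "amap (ftr_comp C G F) (Id C a) = Id E (omap (ftr_comp C G F) a)"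
    if "a \<in> Ob C" for a
    using that C.Id_in[OF that] functor_Id[OF F that] functor_Id[OF G functor_Ob[OF F that]]
    by (auto simp: ftr_comp_def in_Hom_iff)
  show ?thesis
    unfolding is_functor_def
    using functor_category[OF F] functor_category[OF G] ob ar arr comp idm by blast
qed

lemma is_pullbackI:
  assumes "f \<in> Hom C a c" "j \<in> Hom C b c" "p \<in> Hom C e a" "q \<in> Hom C e b"
    and "f \<cdot>\<^bsub>C\<^esub> p = j \<cdot>\<^bsub>C\<^esub> q"
    and "\<And>x u v. \<lbrakk>u \<in> Hom C x a; v \<in> Hom C x b; f \<cdot>\<^bsub>C\<^esub> u = j \<cdot>\<^bsub>C\<^esub> v\<rbrakk>
      \<Longrightarrow> \<exists>!w. w \<in> Hom C x e \<and> p \<cdot>\<^bsub>C\<^esub> w = u \<and> q \<cdot>\<^bsub>C\<^esub> w = v"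
  shows "is_pullback C f j p q"
proof -
  have "Dom C f = a" "Dom C j = b" "Dom C p = e" "f \<in> Ar C" "j \<in> Ar C" "Cod C f = Cod C j"
    using assms(1-3) by (auto simp: in_Hom_iff)
  with assms(3-6) show ?thesis unfolding is_pullback_def by metis
qed

lemma is_pullbackE:
  assumes "is_pullback C f j p q"
  obtains a b c e where "f \<in> Hom C a c" "j \<in> Hom C b c" "p \<in> Hom C e a" "q \<in> Hom C e b"
    "f \<cdot>\<^bsub>C\<^esub> p = j \<cdot>\<^bsub>C\<^esub> q"
  using assms unfolding is_pullback_def by (auto simp: in_Hom_iff)

lemma pullback_mediating:
  assumes "is_pullback C f j p q" "f \<in> Hom C a c" "j \<in> Hom C b c" "p \<in> Hom C e a"
    and "u \<in> Hom C x a" "v \<in> Hom C x b" "f \<cdot>\<^bsub>C\<^esub> u = j \<cdot>\<^bsub>C\<^esub> v"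
  shows "\<exists>!w. w \<in> Hom C x e \<and> p \<cdot>\<^bsub>C\<^esub> w = u \<and> q \<cdot>\<^bsub>C\<^esub> w = v"
proof -
  have "a = Dom C f" "b = Dom C j" "e = Dom C p"
    using assms(2-4) by (auto simp: in_Hom_iff)
  then show ?thesis using assms(1,5-7) unfolding is_pullback_def by blast
qed

lemma (in category) pullback_jointly_monic:
  assumes pb: "is_pullback C f j p q" and p: "p \<in> Hom C e a"
    and w: "w \<in> Hom C x e" and w': "w' \<in> Hom C x e"
    and eqs: "p \<cdot> w = p \<cdot> w'" "q \<cdot> w = q \<cdot> w'"
  shows "w = w'"
proof -
  obtain b c where f: "f \<in> Hom C a c" and j: "j \<in> Hom C b c" and q: "q \<in> Hom C e b"
    and sq: "f \<cdot> p = j \<cdot> q"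
    using pb p by (elim is_pullbackE) (auto simp: in_Hom_iff)
  have "f \<cdot> (p \<cdot> w) = j \<cdot> (q \<cdot> w)"
    using Comp_assoc[OF w p f] Comp_assoc[OF w q j] sq by simp
  from pullback_mediating[OF pb f j p Comp_in[OF w p] Comp_in[OF w q] this]
  show ?thesis using w w' eqs by metis
qed

lemma (in category) pullback_compose_iso:
  assumes pb: "is_pullback C f j p q" and p: "p \<in> Hom C e a"
    and k: "k \<in> Hom C e' e" and l: "l \<in> Hom C e e'"
    and kl: "k \<cdot> l = Id C e" and lk: "l \<cdot> k = Id C e'"
  shows "is_pullback C f j (p \<cdot> k) (q \<cdot> k)"
proof -
  obtain b c where f: "f \<in> Hom C a c" and j: "j \<in> Hom C b c" and q: "q \<in> Hom C e b"
    and sq: "f \<cdot> p = j \<cdot> q"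
    using pb p by (elim is_pullbackE) (auto simp: in_Hom_iff)
  show ?thesis
  proof (rule is_pullbackI[OF f j Comp_in[OF k p] Comp_in[OF k q]])
    show "f \<cdot> p \<cdot> k = j \<cdot> q \<cdot> k"
      using Comp_assoc[OF k p f] Comp_assoc[OF k q j] sq by simp
  next
    fix x u v
    assume u: "u \<in> Hom C x a" and v: "v \<in> Hom C x b" and uv: "f \<cdot> u = j \<cdot> v"
    obtain w where w: "w \<in> Hom C x e" "p \<cdot> w = u" "q \<cdot> w = v"
      using pullback_mediating[OF pb f j p u v uv] by blast
    show "\<exists>!w. w \<in> Hom C x e' \<and> (p \<cdot> k) \<cdot> w = u \<and> (q \<cdot> k) \<cdot> w = v"
    proof (rule ex1I[of _ "l \<cdot> w"], intro conjI)
      have "k \<cdot> (l \<cdot> w) = w"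
        using Comp_assoc[OF w(1) l k] kl Id_left[OF w(1)] by simp
      then show "(p \<cdot> k) \<cdot> l \<cdot> w = u" "(q \<cdot> k) \<cdot> l \<cdot> w = v"
        using Comp_assoc[OF Comp_in[OF w(1) l] k p] Comp_assoc[OF Comp_in[OF w(1) l] k q] w
        by simp_all
      show "l \<cdot> w \<in> Hom C x e'" by (rule Comp_in[OF w(1) l])
    next
      fix z assume z: "z \<in> Hom C x e' \<and> (p \<cdot> k) \<cdot> z = u \<and> (q \<cdot> k) \<cdot> z = v"
      then have z': "z \<in> Hom C x e'" by simp
      have "k \<cdot> z = w"
        using pullback_jointly_monic[OF pb p Comp_in[OF z' k] w(1)]
          Comp_assoc[OF z' k p] Comp_assoc[OF z' k q] z w by simp
      then show "z = l \<cdot> w"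
        using Comp_assoc[OF z' k l] lk Id_left[OF z'] by simp
    qed
  qed
qed

lemma (in category) pullback_unique_up_to_iso:
  assumes pb: "is_pullback C f j p q" and pb': "is_pullback C f j p' q'"
    and p: "p \<in> Hom C e a" and p': "p' \<in> Hom C e' a"
  shows "\<exists>k l. k \<in> Hom C e' e \<and> l \<in> Hom C e e' \<and> k \<cdot> l = Id C e \<and> l \<cdot> k = Id C e' \<and>
    p \<cdot> k = p' \<and> q \<cdot> k = q'"
proof -
  obtain b c where f: "f \<in> Hom C a c" and j: "j \<in> Hom C b c" and q: "q \<in> Hom C e b"
    and sq: "f \<cdot> p = j \<cdot> q"
    using pb p by (elim is_pullbackE) (auto simp: in_Hom_iff)
  have q': "q' \<in> Hom C e' b" and sq': "f \<cdot> p' = j \<cdot> q'"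
    using pb' p' j by (auto elim!: is_pullbackE simp: in_Hom_iff)
  obtain k where k: "k \<in> Hom C e' e" "p \<cdot> k = p'" "q \<cdot> k = q'"
    using pullback_mediating[OF pb f j p p' q' sq'] by blast
  obtain l where l: "l \<in> Hom C e e'" "p' \<cdot> l = p" "q' \<cdot> l = q"
    using pullback_mediating[OF pb' f j p' p q sq] by blast
  have Ob: "e \<in> Ob C" "e' \<in> Ob C" using Hom_Ob k(1) by auto
  have "k \<cdot> l = Id C e"
    by (rule pullback_jointly_monic[OF pb p Comp_in[OF l(1) k(1)] Id_in[OF Ob(1)]])
      (simp_all add: Comp_assoc[OF l(1) k(1) p, symmetric] Comp_assoc[OF l(1) k(1) q, symmetric]
        k l Id_right[OF p] Id_right[OF q])
  moreover have "l \<cdot> k = Id C e'"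
    by (rule pullback_jointly_monic[OF pb' p' Comp_in[OF k(1) l(1)] Id_in[OF Ob(2)]])
      (simp_all add: Comp_assoc[OF k(1) l(1) p', symmetric] Comp_assoc[OF k(1) l(1) q', symmetric]
        k l Id_right[OF p'] Id_right[OF q'])
  ultimately show ?thesis using k l by blast
qed

section \<open>Computability transfers\<close>

lemma transfer_functor: "is_transfer (C, B) (D, E) F \<Longrightarrow> is_functor C D F"
  by (simp add: is_transfer_def)

lemma transfer_base:
  "\<lbrakk>is_transfer (C, B) (D, E) F; a \<in> Ob C; i \<in> B a\<rbrakk> \<Longrightarrow> amap F i \<in> E (omap F a)"
  by (simp add: is_transfer_def)

lemma transfer_pullback:
  assumes "is_transfer (C, B) (D, E) F" "b \<in> Ob C" "j \<in> B b" "f \<in> Hom C s b"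
    "is_pullback C f j p q"
  shows "is_pullback D (amap F f) (amap F j) (amap F p) (amap F q)"
  using assms unfolding is_transfer_def by fastforce

lemma (in base_of_computability) base_Hom:
  "\<lbrakk>a \<in> Ob C; i \<in> B a\<rbrakk> \<Longrightarrow> i \<in> Hom C (Dom C i) a"
  using Base_mono by (fastforce simp: mono_to_def in_Hom_iff)

lemma ftr_comp_transfer:
  assumes F: "is_transfer (C, B) (C', B') F" and G: "is_transfer (C', B') (C'', B'') G"
  shows "is_transfer (C, B) (C'', B'') (ftr_comp C G F)"
proof -
  note fF = transfer_functor[OF F] and fG = transfer_functor[OF G]
  interpret base_of_computability C B
    using F by (simp add: is_transfer_def is_based_cat_def)
  have "amap (ftr_comp C G F) i \<in> B'' (omap (ftr_comp C G F) a)" if "a \<in> Ob C" "i \<in> B a" for a i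
    using that transfer_base[OF G functor_Ob[OF fF that(1)] transfer_base[OF F that]]
      base_Hom[OF that] by (simp add: ftr_comp_def in_Hom_iff)
  moreover have "is_pullback C'' (amap (ftr_comp C G F) f) (amap (ftr_comp C G F) j)
      (amap (ftr_comp C G F) p) (amap (ftr_comp C G F) q)"
    if b: "b \<in> Ob C" and j: "j \<in> B b" and f: "f \<in> Hom C s b" and pb: "is_pullback C f j p q"
    for b j s f p q
  proof -
    have "f \<in> Ar C" "j \<in> Ar C" "p \<in> Ar C" "q \<in> Ar C"
      using pb by (auto elim!: is_pullbackE simp: in_Hom_iff)
    then show ?thesis
      using transfer_pullback[OF G functor_Ob[OF fF b] transfer_base[OF F b j]
          functor_Hom[OF fF f] transfer_pullback[OF F b j f pb]]
      by (simp add: ftr_comp_def)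
  qed
  ultimately show ?thesis
    using F G ftr_comp_functor[OF fF fG] by (simp add: is_transfer_def)
qed

section \<open>The category of dialgebras\<close>

lemma DiAlg_Ob_iff:
  "u \<in> Ob (DiAlg C D F G) \<longleftrightarrow> fst u \<in> Ob C \<and> snd u \<in> Hom D (omap F (fst u)) (omap G (fst u))"
  by (auto simp: DiAlg_def DiAlg_Ob_def)

lemma DiAlg_Ar_iff:
  "(u, f, v) \<in> Ar (DiAlg C D F G) \<longleftrightarrow>
    u \<in> Ob (DiAlg C D F G) \<and> v \<in> Ob (DiAlg C D F G) \<and> f \<in> Hom C (fst u) (fst v) \<and>
    snd v \<cdot>\<^bsub>D\<^esub> amap F f = amap G f \<cdot>\<^bsub>D\<^esub> snd u"
  by (cases u; cases v) (auto simp: DiAlg_def)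

lemma DiAlg_Dom: "Dom (DiAlg C D F G) (u, f, v) = u"
  and DiAlg_Cod: "Cod (DiAlg C D F G) (u, f, v) = v"
  and DiAlg_Id: "Id (DiAlg C D F G) u = (u, Id C (fst u), u)"
  and DiAlg_Comp: "(v, g, w) \<cdot>\<^bsub>DiAlg C D F G\<^esub> (u, f, v') = (u, g \<cdot>\<^bsub>C\<^esub> f, w)"
  by (simp_all add: DiAlg_def)

lemma DiAlg_Hom_iff:
  "(u', f, v') \<in> Hom (DiAlg C D F G) u v \<longleftrightarrow>
    u' = u \<and> v' = v \<and> u \<in> Ob (DiAlg C D F G) \<and> v \<in> Ob (DiAlg C D F G) \<and>
    f \<in> Hom C (fst u) (fst v) \<and> snd v \<cdot>\<^bsub>D\<^esub> amap F f = amap G f \<cdot>\<^bsub>D\<^esub> snd u"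
  by (auto simp: in_Hom_iff[of _ "DiAlg C D F G"] DiAlg_Ar_iff DiAlg_Dom DiAlg_Cod)

lemma DiAlg_HomE:
  assumes "k \<in> Hom (DiAlg C D F G) u v"
  obtains f where "k = (u, f, v)" "u \<in> Ob (DiAlg C D F G)" "v \<in> Ob (DiAlg C D F G)"
    "f \<in> Hom C (fst u) (fst v)" "snd v \<cdot>\<^bsub>D\<^esub> amap F f = amap G f \<cdot>\<^bsub>D\<^esub> snd u"
  using assms by (cases k) (auto simp: DiAlg_Hom_iff)

lemma DiAlg_base_iff:
  "k \<in> DiAlg_base C D F G B v \<longleftrightarrow> (\<exists>u f. k = (u, f, v) \<and> k \<in> Hom (DiAlg C D F G) u v \<and> f \<in> B (fst v))"
  by (cases v) (auto simp: DiAlg_base_def DiAlg_Hom_iff)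

lemma DiAlg_proj_simps:
  "u \<in> Ob (DiAlg C D F G) \<Longrightarrow> omap (DiAlg_proj C D F G) u = fst u"
  "k \<in> Ar (DiAlg C D F G) \<Longrightarrow> amap (DiAlg_proj C D F G) k = fst (snd k)"
  by (auto simp: DiAlg_proj_def split: prod.splits)

lemma DiAlg_trans_simp: "u \<in> Ob (DiAlg C D F G) \<Longrightarrow> DiAlg_trans C D F G u = snd u"
  by (auto simp: DiAlg_trans_def split: prod.splits)

lemma DiAlg_category:
  assumes F: "is_functor C D F" and G: "is_functor C D G"
  shows "category (DiAlg C D F G)"
proof -
  interpret C: category C using F by (simp add: is_functor_def)
  interpret D: category D using F by (simp add: is_functor_def)
  let ?X = "DiAlg C D F G"
  show ?thesis
  proof
    fix k assume "k \<in> Ar ?X"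
    then show "Dom ?X k \<in> Ob ?X" "Cod ?X k \<in> Ob ?X"
      by (cases k, simp add: DiAlg_Ar_iff DiAlg_Dom DiAlg_Cod)+
  next
    fix u assume "u \<in> Ob ?X"
    then show "Id ?X u \<in> Hom ?X u u"
      using C.Id_in functor_Id[OF F] functor_Id[OF G] D.Id_left D.Id_right
      by (auto simp: DiAlg_Id DiAlg_Hom_iff DiAlg_Ob_iff)
  next
    fix k l u v w assume k: "k \<in> Hom ?X u v" and l: "l \<in> Hom ?X v w"
    obtain f where f: "k = (u, f, v)" "u \<in> Ob ?X" "v \<in> Ob ?X" "f \<in> Hom C (fst u) (fst v)"
      "snd v \<cdot>\<^bsub>D\<^esub> amap F f = amap G f \<cdot>\<^bsub>D\<^esub> snd u" using k by (rule DiAlg_HomE)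
    obtain g where g: "l = (v, g, w)" "w \<in> Ob ?X" "g \<in> Hom C (fst v) (fst w)"
      "snd w \<cdot>\<^bsub>D\<^esub> amap F g = amap G g \<cdot>\<^bsub>D\<^esub> snd v" using l by (rule DiAlg_HomE)
    note Ff = functor_Hom[OF F f(4)] and Fg = functor_Hom[OF F g(3)]
      and Gf = functor_Hom[OF G f(4)] and Gg = functor_Hom[OF G g(3)]
    have su: "snd u \<in> Hom D (omap F (fst u)) (omap G (fst u))"
      and sv: "snd v \<in> Hom D (omap F (fst v)) (omap G (fst v))"
      and sw: "snd w \<in> Hom D (omap F (fst w)) (omap G (fst w))"
      using f g by (simp_all add: DiAlg_Ob_iff)
    have "snd w \<cdot>\<^bsub>D\<^esub> amap F g \<cdot>\<^bsub>D\<^esub> amap F f = (amap G g \<cdot>\<^bsub>D\<^esub> amap G f) \<cdot>\<^bsub>D\<^esub> snd u"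
      using D.Comp_assoc[OF Ff Fg sw] D.Comp_assoc[OF Ff sv Gg] D.Comp_assoc[OF su Gf Gg] f g
      by simp
    then show "l \<cdot>\<^bsub>?X\<^esub> k \<in> Hom ?X u w"
      using f g C.Comp_in[OF f(4) g(3)] functor_Comp[OF F f(4) g(3)] functor_Comp[OF G f(4) g(3)]
      by (simp add: DiAlg_Comp DiAlg_Hom_iff)
  next
    fix k u v assume "k \<in> Hom ?X u v"
    then show "Id ?X v \<cdot>\<^bsub>?X\<^esub> k = k" "k \<cdot>\<^bsub>?X\<^esub> Id ?X u = k"
      using C.Id_left C.Id_right by (auto elim!: DiAlg_HomE simp: DiAlg_Comp DiAlg_Id)
  next
    fix k l m t u v w assume "k \<in> Hom ?X t u" "l \<in> Hom ?X u v" "m \<in> Hom ?X v w"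
    then show "(m \<cdot>\<^bsub>?X\<^esub> l) \<cdot>\<^bsub>?X\<^esub> k = m \<cdot>\<^bsub>?X\<^esub> l \<cdot>\<^bsub>?X\<^esub> k"
      using C.Comp_assoc by (auto elim!: DiAlg_HomE simp: DiAlg_Comp)
  qed
qed

lemma DiAlg_proj_functor:
  assumes F: "is_functor C D F" and G: "is_functor C D G"
  shows "is_functor (DiAlg C D F G) C (DiAlg_proj C D F G)"
proof -
  let ?X = "DiAlg C D F G" and ?P = "DiAlg_proj C D F G"
  interpret C: category C using F by (simp add: is_functor_def)
  interpret X: category ?X by (rule DiAlg_category[OF F G])
  have arr: "amap ?P k \<in> Hom C (omap ?P u) (omap ?P v)" if "k \<in> Hom ?X u v" for k u v
    using that by (auto elim!: DiAlg_HomE simp: DiAlg_proj_simps DiAlg_Ar_iff)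
  have "omap ?P \<in> Ob ?X \<rightarrow>\<^sub>E Ob C"
    by (auto simp: DiAlg_proj_def DiAlg_Ob_iff)
  moreover have "amap ?P \<in> Ar ?X \<rightarrow>\<^sub>E Ar C"
    by (auto simp: DiAlg_proj_def DiAlg_Ar_iff in_Hom_iff)
  moreover have "amap ?P (Id ?X u) = Id C (omap ?P u)" if "u \<in> Ob ?X" for u
    using that X.Id_in[OF that] by (simp add: DiAlg_proj_simps in_Hom_iff) (simp add: DiAlg_Id)
  moreover have "amap ?P (l \<cdot>\<^bsub>?X\<^esub> k) = amap ?P l \<cdot>\<^bsub>C\<^esub> amap ?P k"
    if k: "k \<in> Hom ?X u v" and l: "l \<in> Hom ?X v w" for k l u v w
  proof -
    have "l \<cdot>\<^bsub>?X\<^esub> k \<in> Ar ?X" "k \<in> Ar ?X" "l \<in> Ar ?X"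
      using X.Comp_in[OF k l] k l by (simp_all add: in_Hom_iff)
    then show ?thesis
      using k l by (auto elim!: DiAlg_HomE simp: DiAlg_proj_simps DiAlg_Comp)
  qed
  ultimately show ?thesis
    unfolding is_functor_def using C.category_axioms X.category_axioms arr by blast
qed

section \<open>Pullbacks of dialgebras\<close>

text \<open>The existence part of the universal property of \<open>G p\<close>, \<open>G q\<close> produces the structure map.\<close>

lemma pullback_structure:
  assumes F: "is_functor C D F" and G: "is_functor C D G"
    and f: "(s, f, b) \<in> Hom (DiAlg C D F G) s b" and j: "(t, j, b) \<in> Hom (DiAlg C D F G) t b"
    and pb: "is_pullback C f j p q"
    and Gpb: "is_pullback D (amap G f) (amap G j) (amap G p) (amap G q)"
  obtains e where "(e, p, s) \<in> Hom (DiAlg C D F G) e s" "(e, q, t) \<in> Hom (DiAlg C D F G) e t"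
proof -
  let ?X = "DiAlg C D F G"
  interpret C: category C using F by (simp add: is_functor_def)
  interpret D: category D using F by (simp add: is_functor_def)
  have fH: "f \<in> Hom C (fst s) (fst b)" and jH: "j \<in> Hom C (fst t) (fst b)"
    and st: "s \<in> Ob ?X" "t \<in> Ob ?X" "b \<in> Ob ?X"
    and fD: "snd b \<cdot>\<^bsub>D\<^esub> amap F f = amap G f \<cdot>\<^bsub>D\<^esub> snd s"
    and jD: "snd b \<cdot>\<^bsub>D\<^esub> amap F j = amap G j \<cdot>\<^bsub>D\<^esub> snd t"
    using f j by (simp_all add: DiAlg_Hom_iff)
  obtain x where pH: "p \<in> Hom C x (fst s)" and qH: "q \<in> Hom C x (fst t)"
    and sq: "f \<cdot>\<^bsub>C\<^esub> p = j \<cdot>\<^bsub>C\<^esub> q"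
    using pb fH jH by (elim is_pullbackE) (auto simp: in_Hom_iff)
  note Ff = functor_Hom[OF F fH] and Fj = functor_Hom[OF F jH]
    and Fp = functor_Hom[OF F pH] and Fq = functor_Hom[OF F qH]
    and Gf = functor_Hom[OF G fH] and Gj = functor_Hom[OF G jH] and Gp = functor_Hom[OF G pH]
  have ss: "snd s \<in> Hom D (omap F (fst s)) (omap G (fst s))"
    and tt: "snd t \<in> Hom D (omap F (fst t)) (omap G (fst t))"
    and bb: "snd b \<in> Hom D (omap F (fst b)) (omap G (fst b))"
    using st by (simp_all add: DiAlg_Ob_iff)
  have "amap G f \<cdot>\<^bsub>D\<^esub> snd s \<cdot>\<^bsub>D\<^esub> amap F p = snd b \<cdot>\<^bsub>D\<^esub> amap F (f \<cdot>\<^bsub>C\<^esub> p)"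
    using D.Comp_assoc[OF Fp ss Gf] D.Comp_assoc[OF Fp Ff bb] fD functor_Comp[OF F pH fH] by simp
  also have "\<dots> = amap G j \<cdot>\<^bsub>D\<^esub> snd t \<cdot>\<^bsub>D\<^esub> amap F q"
    using D.Comp_assoc[OF Fq tt Gj] D.Comp_assoc[OF Fq Fj bb] jD functor_Comp[OF F qH jH] sq
    by simp
  finally obtain \<pi> where "\<pi> \<in> Hom D (omap F x) (omap G x)"
    "amap G p \<cdot>\<^bsub>D\<^esub> \<pi> = snd s \<cdot>\<^bsub>D\<^esub> amap F p" "amap G q \<cdot>\<^bsub>D\<^esub> \<pi> = snd t \<cdot>\<^bsub>D\<^esub> amap F q"
    using pullback_mediating[OF Gpb Gf Gj Gp D.Comp_in[OF Fp ss] D.Comp_in[OF Fq tt]] by blast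
  then show ?thesis
    using that[of "(x, \<pi>)"] pH qH st C.Hom_Ob[OF pH] by (simp add: DiAlg_Hom_iff DiAlg_Ob_iff)
qed

text \<open>
  A mediating arrow \<open>w\<close> in \<open>C\<close> is a homomorphism because the two sides of its homomorphism
  equation agree after composition with the jointly monic pair \<open>G p\<close>, \<open>G q\<close>.
\<close>

lemma DiAlg_pullback:
  assumes F: "is_functor C D F" and G: "is_functor C D G"
    and f: "(s, f, b) \<in> Hom (DiAlg C D F G) s b" and j: "(t, j, b) \<in> Hom (DiAlg C D F G) t b"
    and p: "(e, p, s) \<in> Hom (DiAlg C D F G) e s" and q: "(e, q, t) \<in> Hom (DiAlg C D F G) e t"
    and pb: "is_pullback C f j p q"
    and Gpb: "is_pullback D (amap G f) (amap G j) (amap G p) (amap G q)"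
  shows "is_pullback (DiAlg C D F G) (s, f, b) (t, j, b) (e, p, s) (e, q, t)"
proof (rule is_pullbackI[OF f j p q])
  let ?X = "DiAlg C D F G"
  interpret C: category C using F by (simp add: is_functor_def)
  interpret D: category D using F by (simp add: is_functor_def)
  have fH: "f \<in> Hom C (fst s) (fst b)" and jH: "j \<in> Hom C (fst t) (fst b)"
    and pH: "p \<in> Hom C (fst e) (fst s)" and qH: "q \<in> Hom C (fst e) (fst t)"
    and st: "s \<in> Ob ?X" "t \<in> Ob ?X" "e \<in> Ob ?X"
    using f j p q by (simp_all add: DiAlg_Hom_iff)
  show "(s, f, b) \<cdot>\<^bsub>?X\<^esub> (e, p, s) = (t, j, b) \<cdot>\<^bsub>?X\<^esub> (e, q, t)"
    using pb by (auto elim: is_pullbackE simp: DiAlg_Comp)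
  fix x k l
  assume k: "k \<in> Hom ?X x s" and l: "l \<in> Hom ?X x t"
    and kl: "(s, f, b) \<cdot>\<^bsub>?X\<^esub> k = (t, j, b) \<cdot>\<^bsub>?X\<^esub> l"
  obtain u where u: "k = (x, u, s)" "x \<in> Ob ?X" "u \<in> Hom C (fst x) (fst s)"
    "snd s \<cdot>\<^bsub>D\<^esub> amap F u = amap G u \<cdot>\<^bsub>D\<^esub> snd x" using k by (rule DiAlg_HomE)
  obtain v where v: "l = (x, v, t)" "v \<in> Hom C (fst x) (fst t)"
    "snd t \<cdot>\<^bsub>D\<^esub> amap F v = amap G v \<cdot>\<^bsub>D\<^esub> snd x" using l by (rule DiAlg_HomE)
  have "f \<cdot>\<^bsub>C\<^esub> u = j \<cdot>\<^bsub>C\<^esub> v" using kl u v by (simp add: DiAlg_Comp)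
  then obtain w where w: "w \<in> Hom C (fst x) (fst e)" "p \<cdot>\<^bsub>C\<^esub> w = u" "q \<cdot>\<^bsub>C\<^esub> w = v"
    using pullback_mediating[OF pb fH jH pH u(3) v(2)] by blast
  have xx: "snd x \<in> Hom D (omap F (fst x)) (omap G (fst x))"
    and ee: "snd e \<in> Hom D (omap F (fst e)) (omap G (fst e))"
    using u st by (simp_all add: DiAlg_Ob_iff)
  note Fw = functor_Hom[OF F w(1)] and Gw = functor_Hom[OF G w(1)]
  have after: "amap G r \<cdot>\<^bsub>D\<^esub> snd e \<cdot>\<^bsub>D\<^esub> amap F w = amap G r \<cdot>\<^bsub>D\<^esub> amap G w \<cdot>\<^bsub>D\<^esub> snd x"
    if r: "(e, r, y) \<in> Hom ?X e y" and rw: "(x, r \<cdot>\<^bsub>C\<^esub> w, y) \<in> Hom ?X x y" for r y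
  proof -
    have rH: "r \<in> Hom C (fst e) (fst y)" and yy: "snd y \<in> Hom D (omap F (fst y)) (omap G (fst y))"
      and rD: "snd y \<cdot>\<^bsub>D\<^esub> amap F r = amap G r \<cdot>\<^bsub>D\<^esub> snd e"
      and rwD: "snd y \<cdot>\<^bsub>D\<^esub> amap F (r \<cdot>\<^bsub>C\<^esub> w) = amap G (r \<cdot>\<^bsub>C\<^esub> w) \<cdot>\<^bsub>D\<^esub> snd x"
      using r rw by (simp_all add: DiAlg_Hom_iff DiAlg_Ob_iff)
    note Fr = functor_Hom[OF F rH] and Gr = functor_Hom[OF G rH]
    have "amap G r \<cdot>\<^bsub>D\<^esub> snd e \<cdot>\<^bsub>D\<^esub> amap F w = snd y \<cdot>\<^bsub>D\<^esub> amap F (r \<cdot>\<^bsub>C\<^esub> w)"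
      using D.Comp_assoc[OF Fw ee Gr] D.Comp_assoc[OF Fw Fr yy] rD functor_Comp[OF F w(1) rH]
      by simp
    also have "\<dots> = amap G r \<cdot>\<^bsub>D\<^esub> amap G w \<cdot>\<^bsub>D\<^esub> snd x"
      using rwD functor_Comp[OF G w(1) rH] D.Comp_assoc[OF xx Gw Gr] by simp
    finally show ?thesis .
  qed
  have "snd e \<cdot>\<^bsub>D\<^esub> amap F w = amap G w \<cdot>\<^bsub>D\<^esub> snd x"
    using D.pullback_jointly_monic[OF Gpb functor_Hom[OF G pH] D.Comp_in[OF Fw ee]
        D.Comp_in[OF xx Gw]] after[OF p] after[OF q] k l u v w by simp
  then have wH: "(x, w, e) \<in> Hom ?X x e"
    using w u st by (simp add: DiAlg_Hom_iff)
  have uniq: "z = (x, w, e)"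
    if z: "z \<in> Hom ?X x e" "(e, p, s) \<cdot>\<^bsub>?X\<^esub> z = k" "(e, q, t) \<cdot>\<^bsub>?X\<^esub> z = l" for z
    using z(1)
  proof (rule DiAlg_HomE)
    fix w' assume w': "z = (x, w', e)" "w' \<in> Hom C (fst x) (fst e)"
    have "p \<cdot>\<^bsub>C\<^esub> w' = p \<cdot>\<^bsub>C\<^esub> w" "q \<cdot>\<^bsub>C\<^esub> w' = q \<cdot>\<^bsub>C\<^esub> w"
      using z(2,3) w w'(1) u(1) v(1) by (simp_all add: DiAlg_Comp)
    then have "w' = w" by (rule C.pullback_jointly_monic[OF pb pH w'(2) w(1)])
    with w'(1) show ?thesis by simp
  qed
  have "(e, p, s) \<cdot>\<^bsub>?X\<^esub> (x, w, e) = k" "(e, q, t) \<cdot>\<^bsub>?X\<^esub> (x, w, e) = l"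
    using u(1) v(1) w by (simp_all add: DiAlg_Comp)
  with wH uniq show "\<exists>!z. z \<in> Hom ?X x e \<and> (e, p, s) \<cdot>\<^bsub>?X\<^esub> z = k \<and> (e, q, t) \<cdot>\<^bsub>?X\<^esub> z = l"
    by blast
qed

section \<open>The base of computability on dialgebras\<close>

locale parallel_transfers =
  fixes C :: "('o, 'm) cat" and B :: "'o \<Rightarrow> 'm set"
    and D :: "('p, 'n) cat" and E :: "'p \<Rightarrow> 'n set"
    and F G :: "('o, 'm, 'p, 'n) ftr"
  assumes transfer_F: "is_transfer (C, B) (D, E) F"
    and transfer_G: "is_transfer (C, B) (D, E) G"
begin

abbreviation "\<X> \<equiv> DiAlg C D F G"
abbreviation "\<B> \<equiv> DiAlg_base C D F G B"
abbreviation "P \<equiv> DiAlg_proj C D F G"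
abbreviation "\<tau> \<equiv> DiAlg_trans C D F G"

lemmas F = transfer_functor[OF transfer_F]
lemmas G = transfer_functor[OF transfer_G]

sublocale C: base_of_computability C B
  using transfer_F by (simp add: is_transfer_def is_based_cat_def)

sublocale X: category \<X>
  by (rule DiAlg_category[OF F G])

lemma base_pullback_lift:
  assumes f: "(s, f, b) \<in> Hom \<X> s b" and j: "(t, j, b) \<in> \<B> b" and pb: "is_pullback C f j p q"
  obtains e where "(e, p, s) \<in> Hom \<X> e s" "(e, q, t) \<in> Hom \<X> e t"
    "is_pullback \<X> (s, f, b) (t, j, b) (e, p, s) (e, q, t)"
proof -
  have j': "(t, j, b) \<in> Hom \<X> t b" "j \<in> B (fst b)"
    using j by (auto simp: DiAlg_base_iff)
  have b: "fst b \<in> Ob C" "f \<in> Hom C (fst s) (fst b)"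
    using f by (auto simp: DiAlg_Hom_iff DiAlg_Ob_iff)
  note Gpb = transfer_pullback[OF transfer_G b(1) j'(2) b(2) pb]
  obtain e where e: "(e, p, s) \<in> Hom \<X> e s" "(e, q, t) \<in> Hom \<X> e t"
    using pullback_structure[OF F G f j'(1) pb Gpb] .
  with that DiAlg_pullback[OF F G f j'(1) e pb Gpb] show ?thesis by blast
qed

lemma DiAlg_based_cat: "is_based_cat (\<X>, \<B>)"
proof -
  have "base_of_computability \<X> \<B>"
  proof
    fix c assume c: "c \<in> Ob \<X>"
    then have c': "fst c \<in> Ob C" by (simp add: DiAlg_Ob_iff)
    show "Id \<X> c \<in> \<B> c"
      using X.Id_in[OF c] C.Base1[OF c'] by (auto simp: DiAlg_base_iff DiAlg_Id)
    show "\<B> c \<subseteq> mono_to \<X> c"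
    proof
      fix k assume "k \<in> \<B> c"
      then obtain u i where k: "k = (u, i, c)" "k \<in> Hom \<X> u c" "i \<in> B (fst c)"
        by (auto simp: DiAlg_base_iff)
      have "i \<in> Hom C (fst u) (fst c)" using k by (simp add: DiAlg_Hom_iff)
      then have mono: "g = h"
        if "g \<in> Hom C x (fst u)" "h \<in> Hom C x (fst u)" "i \<cdot>\<^bsub>C\<^esub> g = i \<cdot>\<^bsub>C\<^esub> h" for x g h
        using C.Base_mono[OF c'] k(3) that unfolding mono_to_def by (auto simp: in_Hom_iff)
      have "g = h" if "g \<in> Hom \<X> x u" "h \<in> Hom \<X> x u" "k \<cdot>\<^bsub>\<X>\<^esub> g = k \<cdot>\<^bsub>\<X>\<^esub> h" for x g h
        using that mono k(1) by (auto elim!: DiAlg_HomE simp: DiAlg_Comp)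
      then show "k \<in> mono_to \<X> c"
        using k(2) by (auto simp: mono_to_def in_Hom_iff)
    qed
  next
    fix a b i j f
    assume a: "a \<in> Ob \<X>" and b: "b \<in> Ob \<X>" and i: "i \<in> \<B> a" and j: "j \<in> \<B> b"
      and f: "f \<in> Hom \<X> (Dom \<X> i) b"
    obtain s i' where i': "i = (s, i', a)" "i \<in> Hom \<X> s a" "i' \<in> B (fst a)"
      using i by (auto simp: DiAlg_base_iff)
    obtain t j' where j': "j = (t, j', b)" "j' \<in> B (fst b)"
      using j by (auto simp: DiAlg_base_iff)
    obtain f' where f': "f = (s, f', b)" "f' \<in> Hom C (fst s) (fst b)"
      using f i' by (auto simp: DiAlg_Dom elim: DiAlg_HomE)
    have "i' \<in> Hom C (fst s) (fst a)" using i' by (simp add: DiAlg_Hom_iff)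
    then have "Dom C i' = fst s" by (simp add: in_Hom_iff)
    then obtain p q where pq: "is_pullback C f' j' p q" "i' \<cdot>\<^bsub>C\<^esub> p \<in> B (fst a)"
      using C.Base2[of "fst a" "fst b" i' j' f'] a b i' j' f' by (auto simp: DiAlg_Ob_iff)
    have sf: "(s, f', b) \<in> Hom \<X> s b" using f f' i' by (simp add: DiAlg_Dom)
    have tj: "(t, j', b) \<in> \<B> b" using j j' by simp
    obtain e where e: "(e, p, s) \<in> Hom \<X> e s" "is_pullback \<X> f j (e, p, s) (e, q, t)"
      unfolding f'(1) j'(1) by (rule base_pullback_lift[OF sf tj pq(1)])
    have "i \<cdot>\<^bsub>\<X>\<^esub> (e, p, s) \<in> \<B> a"
      using X.Comp_in[OF e(1) i'(2)] pq(2) i'(1) by (auto simp: DiAlg_base_iff DiAlg_Comp)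
    then show "\<exists>p q. is_pullback \<X> f j p q \<and> i \<cdot>\<^bsub>\<X>\<^esub> p \<in> \<B> a"
      using e(2) by blast
  qed
  then show ?thesis by (simp add: is_based_cat_def)
qed

text \<open>
  A pullback in the category of dialgebras is isomorphic to the one lifted from a pullback of the
  underlying arrows, and the projection sends the isomorphism to an isomorphism of \<open>C\<close>.
\<close>

lemma proj_pullback:
  assumes j: "j \<in> \<B> b" and f: "f \<in> Hom \<X> s b" and pb: "is_pullback \<X> f j p q"
  shows "is_pullback C (amap P f) (amap P j) (amap P p) (amap P q)"
proof -
  note PF = DiAlg_proj_functor[OF F G]
  obtain t j' where j': "j = (t, j', b)" "j \<in> Hom \<X> t b" "j' \<in> B (fst b)"
    using j by (auto simp: DiAlg_base_iff)
  obtain f' where f': "f = (s, f', b)" "s \<in> Ob \<X>" "b \<in> Ob \<X>" "f' \<in> Hom C (fst s) (fst b)"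
    using f by (auto elim: DiAlg_HomE)
  have ob: "fst s \<in> Ob C" "fst b \<in> Ob C" using f' by (simp_all add: DiAlg_Ob_iff)
  \<comment> \<open>Identities lie in the base, so the base axiom makes base arrows pull back along all arrows.\<close>
  have "f' \<in> Hom C (Dom C (Id C (fst s))) (fst b)"
    using f'(4) C.Id_in[OF ob(1)] by (simp add: in_Hom_iff)
  then obtain p' q' where pq': "is_pullback C f' j' p' q'"
    using C.Base2[OF ob C.Base1[OF ob(1)] j'(3)] by blast
  obtain d where d: "(d, p', s) \<in> Hom \<X> d s" "(d, q', t) \<in> Hom \<X> d t"
    "is_pullback \<X> f j (d, p', s) (d, q', t)"
    using base_pullback_lift[OF f[unfolded f'(1)] j[unfolded j'(1)] pq']
    unfolding f'(1) j'(1) .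
  obtain e where p: "p \<in> Hom \<X> e s"
    using pb f by (elim is_pullbackE) (simp add: in_Hom_iff)
  obtain k l where kl: "k \<in> Hom \<X> e d" "l \<in> Hom \<X> d e"
      "k \<cdot>\<^bsub>\<X>\<^esub> l = Id \<X> d" "l \<cdot>\<^bsub>\<X>\<^esub> k = Id \<X> e"
      "(d, p', s) \<cdot>\<^bsub>\<X>\<^esub> k = p" "(d, q', t) \<cdot>\<^bsub>\<X>\<^esub> k = q"
    using X.pullback_unique_up_to_iso[OF d(3) pb d(1) p] by blast
  have Ps: "amap P (d, p', s) = p'" "amap P (d, q', t) = q'" "amap P f = f'" "amap P j = j'"
    using d f j' f' by (simp_all add: DiAlg_proj_simps in_Hom_iff)
  have ob': "d \<in> Ob \<X>" "e \<in> Ob \<X>" using X.Hom_Ob[OF kl(1)] by simp_all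
  have "is_pullback C f' j' (p' \<cdot>\<^bsub>C\<^esub> amap P k) (q' \<cdot>\<^bsub>C\<^esub> amap P k)"
  proof (rule C.pullback_compose_iso[OF pq'])
    show "p' \<in> Hom C (omap P d) (omap P s)" using functor_Hom[OF PF d(1)] Ps by simp
    show "amap P k \<in> Hom C (omap P e) (omap P d)" by (rule functor_Hom[OF PF kl(1)])
    show "amap P l \<in> Hom C (omap P d) (omap P e)" by (rule functor_Hom[OF PF kl(2)])
    show "amap P k \<cdot>\<^bsub>C\<^esub> amap P l = Id C (omap P d)"
      using functor_Comp[OF PF kl(2,1)] kl(3) functor_Id[OF PF ob'(1)] by simp
    show "amap P l \<cdot>\<^bsub>C\<^esub> amap P k = Id C (omap P e)"
      using functor_Comp[OF PF kl(1,2)] kl(4) functor_Id[OF PF ob'(2)] by simp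
  qed
  then show ?thesis
    using functor_Comp[OF PF kl(1) d(1)] functor_Comp[OF PF kl(1) d(2)] kl(5,6) Ps by simp
qed

lemma proj_transfer: "is_transfer (\<X>, \<B>) (C, B) P"
proof -
  have "amap P k \<in> B (omap P a)" if "a \<in> Ob \<X>" "k \<in> \<B> a" for a k
    using that by (auto simp: DiAlg_base_iff DiAlg_proj_simps in_Hom_iff)
  moreover have "is_based_cat (C, B)"
    using C.base_of_computability_axioms by (simp add: is_based_cat_def)
  ultimately show ?thesis
    using DiAlg_based_cat DiAlg_proj_functor[OF F G] proj_pullback
    unfolding is_transfer_def fst_conv snd_conv by blast
qed

lemma trans_inserter_data: "inserter_data (C, B) (D, E) F G (\<X>, \<B>) P \<tau>"
proof -
  note PF = DiAlg_proj_functor[OF F G]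
  have "\<tau> v \<cdot>\<^bsub>D\<^esub> amap (ftr_comp \<X> F P) k = amap (ftr_comp \<X> G P) k \<cdot>\<^bsub>D\<^esub> \<tau> u"
    if "k \<in> Hom \<X> u v" for u v k
    using that by (auto elim!: DiAlg_HomE
        simp: DiAlg_trans_simp ftr_comp_def DiAlg_Ar_iff DiAlg_proj_simps)
  moreover have "\<tau> u \<in> Hom D (omap (ftr_comp \<X> F P) u) (omap (ftr_comp \<X> G P) u)"
    if "u \<in> Ob \<X>" for u
    using that by (simp add: DiAlg_trans_simp ftr_comp_def DiAlg_proj_simps)
      (simp add: DiAlg_Ob_iff)
  moreover have "\<tau> \<in> extensional (Ob \<X>)"
    by (simp add: DiAlg_trans_def)
  ultimately have "is_nat_trans \<X> D (ftr_comp \<X> F P) (ftr_comp \<X> G P) \<tau>"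
    unfolding is_nat_trans_def using ftr_comp_functor[OF PF F] ftr_comp_functor[OF PF G] by blast
  then show ?thesis
    using proj_transfer ftr_comp_transfer[OF proj_transfer transfer_F]
      ftr_comp_transfer[OF proj_transfer transfer_G]
    by (simp add: inserter_data_def is_2cell_def)
qed

section \<open>The universal property\<close>

definition pairing ::
  "('jo, 'jm) cat \<Rightarrow> ('jo, 'jm, 'o, 'm) ftr \<Rightarrow> ('jo \<Rightarrow> 'n)
    \<Rightarrow> ('jo, 'jm, 'o \<times> 'n, ('o \<times> 'n) \<times> 'm \<times> ('o \<times> 'n)) ftr" where
  "pairing J j \<beta> =
    Ftr (\<lambda>x \<in> Ob J. (omap j x, \<beta> x))
      (\<lambda>f \<in> Ar J. ((omap j (Dom J f), \<beta> (Dom J f)), amap j f, (omap j (Cod J f), \<beta> (Cod J f))))"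

lemma pairing_simps:
  "x \<in> Ob J \<Longrightarrow> omap (pairing J j \<beta>) x = (omap j x, \<beta> x)"
  "f \<in> Hom J x y \<Longrightarrow> amap (pairing J j \<beta>) f = ((omap j x, \<beta> x), amap j f, (omap j y, \<beta> y))"
  by (auto simp: pairing_def in_Hom_iff)

context
  fixes J :: "('jo, 'jm) cat" and K :: "'jo \<Rightarrow> 'jm set" and j \<beta>
  assumes data: "inserter_data (C, B) (D, E) F G (J, K) j \<beta>"
begin

lemma data_transfer: "is_transfer (J, K) (C, B) j"
  using data by (simp add: inserter_data_def)

lemmas data_functor = transfer_functor[OF data_transfer]

lemma data_base: "base_of_computability J K"
  using data_transfer by (simp add: is_transfer_def is_based_cat_def)

interpretation J: base_of_computability J K by (rule data_base)

lemma data_nat_trans: "is_nat_trans J D (ftr_comp J F j) (ftr_comp J G j) \<beta>"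
  using data by (simp add: inserter_data_def is_2cell_def)

lemma pair_Ob:
  assumes "x \<in> Ob J"
  shows "(omap j x, \<beta> x) \<in> Ob \<X>"
  using data_nat_trans assms functor_Ob[OF data_functor assms]
  by (auto simp: is_nat_trans_def DiAlg_Ob_iff ftr_comp_def)

text \<open>Naturality of \<open>\<beta>\<close> is the homomorphism equation.\<close>

lemma pairing_Hom:
  assumes "f \<in> Hom J x y"
  shows "amap (pairing J j \<beta>) f \<in> Hom \<X> (omap j x, \<beta> x) (omap j y, \<beta> y)"
proof -
  have "\<beta> y \<cdot>\<^bsub>D\<^esub> amap (ftr_comp J F j) f = amap (ftr_comp J G j) f \<cdot>\<^bsub>D\<^esub> \<beta> x"
    using data_nat_trans assms unfolding is_nat_trans_def by blast
  moreover have "f \<in> Ar J" using assms by (simp add: in_Hom_iff)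
  ultimately show ?thesis
    using assms J.Hom_Ob[OF assms] functor_Hom[OF data_functor assms]
    by (simp add: pairing_simps DiAlg_Hom_iff pair_Ob ftr_comp_def)
qed

lemma pairing_functor: "is_functor J \<X> (pairing J j \<beta>)"
proof -
  let ?h = "pairing J j \<beta>"
  have "omap ?h \<in> Ob J \<rightarrow>\<^sub>E Ob \<X>"
    using pair_Ob by (auto simp: pairing_def)
  moreover have "amap ?h \<in> Ar J \<rightarrow>\<^sub>E Ar \<X>"
    using pairing_Hom by (fastforce simp: in_Hom_iff pairing_def)
  moreover have "amap ?h f \<in> Hom \<X> (omap ?h x) (omap ?h y)" if "f \<in> Hom J x y" for f x y
    using that pairing_Hom[OF that] J.Hom_Ob[OF that] by (simp add: pairing_simps(1))
  moreover have "amap ?h (Id J x) = Id \<X> (omap ?h x)" if "x \<in> Ob J" for x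
    using that J.Id_in[OF that] functor_Id[OF data_functor that]
    by (simp add: pairing_simps DiAlg_Id)
  moreover have "amap ?h (g \<cdot>\<^bsub>J\<^esub> f) = amap ?h g \<cdot>\<^bsub>\<X>\<^esub> amap ?h f"
    if "f \<in> Hom J x y" "g \<in> Hom J y z" for f g x y z
    using that J.Comp_in[OF that] functor_Comp[OF data_functor that]
    by (simp add: pairing_simps DiAlg_Comp)
  ultimately show ?thesis
    unfolding is_functor_def using J.category_axioms X.category_axioms by blast
qed

text \<open>
  Both \<open>j\<close> and the composite of \<open>G\<close> with \<open>j\<close> preserve the given pullback, so it can be reflected
  along the projection.
\<close>

lemma pairing_pullback:
  assumes b: "b \<in> Ob J" and i: "i \<in> K b" and f: "f \<in> Hom J s b" and pb: "is_pullback J f i p q"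
  shows "is_pullback \<X> (amap (pairing J j \<beta>) f) (amap (pairing J j \<beta>) i)
    (amap (pairing J j \<beta>) p) (amap (pairing J j \<beta>) q)"
proof -
  obtain t e where i': "i \<in> Hom J t b" and p: "p \<in> Hom J e s" and q: "q \<in> Hom J e t"
    using pb f by (elim is_pullbackE) (auto simp: in_Hom_iff)
  note Cpb = transfer_pullback[OF data_transfer b i f pb]
  note Gpb = transfer_pullback[OF transfer_G functor_Ob[OF data_functor b]
      transfer_base[OF data_transfer b i] functor_Hom[OF data_functor f] Cpb]
  note arrows = pairing_simps(2)[OF f] pairing_simps(2)[OF i'] pairing_simps(2)[OF p]
    pairing_simps(2)[OF q]
  show ?thesis
    unfolding arrows
    by (rule DiAlg_pullback[OF F G pairing_Hom[OF f, unfolded arrows]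
          pairing_Hom[OF i', unfolded arrows] pairing_Hom[OF p, unfolded arrows]
          pairing_Hom[OF q, unfolded arrows] Cpb Gpb])
qed

lemma pairing_transfer: "is_transfer (J, K) (\<X>, \<B>) (pairing J j \<beta>)"
proof -
  have "amap (pairing J j \<beta>) i \<in> \<B> (omap (pairing J j \<beta>) a)"
    if a: "a \<in> Ob J" and i: "i \<in> K a" for a i
  proof -
    note iH = J.base_Hom[OF a i]
    show ?thesis
      using pairing_Hom[OF iH] transfer_base[OF data_transfer a i]
      unfolding pairing_simps(1)[OF a] pairing_simps(2)[OF iH] DiAlg_base_iff by auto
  qed
  moreover have "is_based_cat (J, K)"
    using data_base by (simp add: is_based_cat_def)
  ultimately show ?thesis
    using DiAlg_based_cat pairing_functor pairing_pullback
    unfolding is_transfer_def fst_conv snd_conv by blast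
qed

lemma pairing_induced: "is_induced (\<X>, \<B>) P \<tau> (J, K) j \<beta> (pairing J j \<beta>)"
proof -
  have ext: "omap j \<in> extensional (Ob J)" "amap j \<in> extensional (Ar J)" "\<beta> \<in> extensional (Ob J)"
    using data_functor data_nat_trans by (auto simp: is_functor_def is_nat_trans_def PiE_def)
  have "omap (ftr_comp J P (pairing J j \<beta>)) = omap j"
    using pair_Ob
    by (intro extensionalityI[OF _ ext(1)])
      (auto simp: ftr_comp_def pairing_simps DiAlg_proj_simps)
  moreover have "amap (ftr_comp J P (pairing J j \<beta>)) = amap j"
  proof (rule extensionalityI[OF _ ext(2)])
    fix f assume "f \<in> Ar J"
    then have f: "f \<in> Hom J (Dom J f) (Cod J f)" by (simp add: in_Hom_iff)
    have "amap (pairing J j \<beta>) f \<in> Ar \<X>" using pairing_Hom[OF f] by (simp add: in_Hom_iff)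
    then show "amap (ftr_comp J P (pairing J j \<beta>)) f = amap j f"
      using \<open>f \<in> Ar J\<close> by (simp add: ftr_comp_def DiAlg_proj_simps) (simp add: pairing_def)
  qed (simp add: ftr_comp_def)
  moreover have "whisker_right J \<tau> (pairing J j \<beta>) = \<beta>"
    using pair_Ob
    by (intro extensionalityI[OF _ ext(3)])
      (auto simp: whisker_right_def pairing_simps DiAlg_trans_simp)
  ultimately show ?thesis
    using pairing_transfer by (simp add: is_induced_def ftr.expand)
qed

text \<open>
  The two equations on \<open>h\<close> prescribe both coordinates of a dialgebra \<open>h x\<close>; an arrow \<open>h f\<close> then has
  prescribed ends and a prescribed underlying arrow.
\<close>

lemma induced_eq_pairing:
  assumes h: "is_induced (\<X>, \<B>) P \<tau> (J, K) j \<beta> h"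
  shows "h = pairing J j \<beta>"
proof -
  have hF: "is_functor J \<X> h" and j: "ftr_comp J P h = j" and \<beta>: "whisker_right J \<tau> h = \<beta>"
    using h by (auto simp: is_induced_def is_transfer_def)
  have ob: "omap h x = (omap j x, \<beta> x)" if "x \<in> Ob J" for x
  proof -
    have hx: "omap h x \<in> Ob \<X>" using functor_Ob[OF hF that] .
    have "omap j x = fst (omap h x)"
      using that hx by (simp add: j[symmetric] ftr_comp_def DiAlg_proj_simps)
    moreover have "\<beta> x = snd (omap h x)"
      using that hx by (simp add: \<beta>[symmetric] whisker_right_def DiAlg_trans_simp)
    ultimately show ?thesis by simp
  qed
  have "omap h = omap (pairing J j \<beta>)"
    using hF by (intro extensionalityI[of _ "Ob J"])
      (auto simp: is_functor_def PiE_def pairing_simps ob, simp add: pairing_def)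
  moreover have "amap h = amap (pairing J j \<beta>)"
  proof (rule extensionalityI[of _ "Ar J"])
    fix f assume fA: "f \<in> Ar J"
    then have f: "f \<in> Hom J (Dom J f) (Cod J f)" by (simp add: in_Hom_iff)
    have hf: "amap h f \<in> Hom \<X> (omap h (Dom J f)) (omap h (Cod J f))"
      by (rule functor_Hom[OF hF f])
    then have "amap j f = fst (snd (amap h f))"
      using fA by (simp add: j[symmetric] ftr_comp_def DiAlg_proj_simps in_Hom_iff)
    then show "amap h f = amap (pairing J j \<beta>) f"
      using hf ob J.Dom_in[OF fA] J.Cod_in[OF fA]
      by (auto elim!: DiAlg_HomE simp: pairing_simps(2)[OF f])
  qed (use hF in \<open>auto simp: is_functor_def PiE_def pairing_def\<close>)
  ultimately show ?thesis by (simp add: ftr.expand)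
qed

end

text \<open>
  A 2-cell between functors into the category of dialgebras is determined by its underlying
  transformation, because an arrow between given dialgebras is determined by its underlying arrow.
\<close>

lemma induced_2cell:
  assumes d: "inserter_data (C, B) (D, E) F G (J, K) j \<beta>"
    and d': "inserter_data (C, B) (D, E) F G (J, K) j' \<beta>'"
    and h: "is_induced (\<X>, \<B>) P \<tau> (J, K) j \<beta> h"
    and h': "is_induced (\<X>, \<B>) P \<tau> (J, K) j' \<beta>' h'"
    and \<nu>: "is_2cell (J, K) (C, B) j j' \<nu>"
    and compat: "vcomp J D \<beta>' (whisker_left J F \<nu>) = vcomp J D (whisker_left J G \<nu>) \<beta>"
  shows "\<exists>!\<mu>. is_2cell (J, K) (\<X>, \<B>) h h' \<mu> \<and> whisker_left J P \<mu> = \<nu>"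
proof -
  interpret J: base_of_computability J K by (rule data_base[OF d])
  have hp: "h = pairing J j \<beta>" "h' = pairing J j' \<beta>'"
    using induced_eq_pairing[OF d h] induced_eq_pairing[OF d' h'] by auto
  have hT: "is_transfer (J, K) (\<X>, \<B>) h" "is_transfer (J, K) (\<X>, \<B>) h'"
    using h h' by (auto simp: is_induced_def)
  have \<nu>ext: "\<nu> \<in> extensional (Ob J)"
    and \<nu>Hom: "\<And>x. x \<in> Ob J \<Longrightarrow> \<nu> x \<in> Hom C (omap j x) (omap j' x)"
    and \<nu>nat: "\<And>f x y. f \<in> Hom J x y \<Longrightarrow> \<nu> y \<cdot>\<^bsub>C\<^esub> amap j f = amap j' f \<cdot>\<^bsub>C\<^esub> \<nu> x"
    using \<nu> by (auto simp: is_2cell_def is_nat_trans_def)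
  define \<mu> where "\<mu> = (\<lambda>x \<in> Ob J. (omap h x, \<nu> x, omap h' x))"
  have \<mu>Hom: "\<mu> x \<in> Hom \<X> (omap h x) (omap h' x)" if x: "x \<in> Ob J" for x
  proof -
    have "\<beta>' x \<cdot>\<^bsub>D\<^esub> amap F (\<nu> x) = amap G (\<nu> x) \<cdot>\<^bsub>D\<^esub> \<beta> x"
      using fun_cong[OF compat, of x] x by (simp add: vcomp_def whisker_left_def)
    then show ?thesis
      using x pair_Ob[OF d x] pair_Ob[OF d' x] \<nu>Hom[OF x]
      by (simp add: \<mu>_def hp pairing_simps DiAlg_Hom_iff)
  qed
  have "\<mu> y \<cdot>\<^bsub>\<X>\<^esub> amap h f = amap h' f \<cdot>\<^bsub>\<X>\<^esub> \<mu> x" if f: "f \<in> Hom J x y" for f x y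
    using J.Hom_Ob[OF f] \<nu>nat[OF f]
    by (simp add: \<mu>_def hp pairing_simps(1) pairing_simps(2)[OF f] DiAlg_Comp)
  then have "is_nat_trans J \<X> h h' \<mu>"
    using \<mu>Hom transfer_functor[OF hT(1)] transfer_functor[OF hT(2)]
    by (auto simp: is_nat_trans_def \<mu>_def)
  then have cell: "is_2cell (J, K) (\<X>, \<B>) h h' \<mu>"
    using hT by (simp add: is_2cell_def)
  have under: "whisker_left J P \<mu> = \<nu>"
  proof (rule extensionalityI[OF _ \<nu>ext])
    fix x assume x: "x \<in> Ob J"
    then have "\<mu> x \<in> Ar \<X>" using \<mu>Hom by (simp add: in_Hom_iff)
    then show "whisker_left J P \<mu> x = \<nu> x"
      using x by (simp add: whisker_left_def DiAlg_proj_simps) (simp add: \<mu>_def)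
  qed (simp add: whisker_left_def)
  have "\<mu>' = \<mu>" if c: "is_2cell (J, K) (\<X>, \<B>) h h' \<mu>'" and u: "whisker_left J P \<mu>' = \<nu>" for \<mu>'
  proof (rule extensionalityI[of _ "Ob J"])
    show "\<mu>' \<in> extensional (Ob J)" "\<mu> \<in> extensional (Ob J)"
      using c by (auto simp: is_2cell_def is_nat_trans_def \<mu>_def)
    fix x assume x: "x \<in> Ob J"
    have m: "\<mu>' x \<in> Hom \<X> (omap h x) (omap h' x)"
      using c x by (simp add: is_2cell_def is_nat_trans_def)
    then have "\<nu> x = fst (snd (\<mu>' x))"
      using x by (simp add: u[symmetric] whisker_left_def DiAlg_proj_simps in_Hom_iff)
    then show "\<mu>' x = \<mu> x"
      using m x by (auto elim!: DiAlg_HomE simp: \<mu>_def)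
  qed
  with cell under show ?thesis by blast
qed

end

theorem lemma3p6:
  fixes \<C> :: "('o, 'm) cat" and C :: "'o \<Rightarrow> 'm set"
    and \<D> :: "('p, 'n) cat" and D :: "'p \<Rightarrow> 'n set"
    and F G :: "('o, 'm, 'p, 'n) ftr"
  assumes "is_transfer (\<C>, C) (\<D>, D) F"
    and "is_transfer (\<C>, C) (\<D>, D) G"
  shows "is_inserter TYPE('jo) TYPE('jm) (\<C>, C) (\<D>, D) F G
    (DiAlg \<C> \<D> F G, DiAlg_base \<C> \<D> F G C)
    (DiAlg_proj \<C> \<D> F G) (DiAlg_trans \<C> \<D> F G)"
proof -
  interpret parallel_transfers \<C> C \<D> D F G
    using assms by unfold_locales
  have "\<exists>!h. is_induced (\<X>, \<B>) P \<tau> J j \<beta> h"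
    if "inserter_data (\<C>, C) (\<D>, D) F G J j \<beta>"
    for J :: "('jo, 'jm) based_cat" and j \<beta>
    using that pairing_induced[of "fst J" "snd J"] induced_eq_pairing[of "fst J" "snd J"]
    by (metis prod.collapse)
  moreover have "\<exists>!\<mu>. is_2cell J (\<X>, \<B>) h h' \<mu> \<and> whisker_left (fst J) P \<mu> = \<nu>"
    if "inserter_data (\<C>, C) (\<D>, D) F G J j \<beta>" "inserter_data (\<C>, C) (\<D>, D) F G J j' \<beta>'"
      "is_induced (\<X>, \<B>) P \<tau> J j \<beta> h" "is_induced (\<X>, \<B>) P \<tau> J j' \<beta>' h'"
      "is_2cell J (\<C>, C) j j' \<nu>"
      "vcomp (fst J) \<D> \<beta>' (whisker_left (fst J) F \<nu>) = vcomp (fst J) \<D> (whisker_left (fst J) G \<nu>) \<beta>"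
    for J :: "('jo, 'jm) based_cat" and j \<beta> j' \<beta>' h h' \<nu>
    using that induced_2cell[of "fst J" "snd J" j \<beta> j' \<beta>' h h' \<nu>] by simp
  ultimately show ?thesis
    unfolding is_inserter_def using DiAlg_based_cat trans_inserter_data by simp
qed

end
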